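(* The group $\mathrm{QI}^{+}(\mathbb{R})$ is not simple, and the group $\mathrm{QI}([0,+\infty))$ is not simple.
   Context: A function $f:X\to Y$ between metric spaces is a quasi-isometry if there exist real numbers $K\ge 1$, $C\ge 0$ such that $\frac1K d(x_1,x_2)-C\le d(f(x_1),f(x_2))\le K d(x_1,x_2)+C$ for all $x_1,x_2\in X$, and $d(\mathrm{Im} f,y)\le C$ for every $y\in Y$. Two quasi-isometries $f,g$ are equivalent if $\sup_{x\in X}d(f(x),g(x))<\infty$. The quasi-isometry group $\mathrm{QI}(X)$ is the group of equivalence classes $[f]$ of quasi-isometries $f:X\to X$ under composition. The real line $\mathbb{R}$ and the ray $[0,+\infty)$ carry the usual metric. $\mathrm{QI}^{+}(\mathbb{R})\le \mathrm{QI}(\mathbb{R})$ is the orientation-preserving subgroup: the classes $[f]$ with $f(x)\to+\infty$ as $x\to+\infty$ and $f(x)\to-\infty$ as $x\to-\infty$ (equivalently, the classes represented by increasing homeomorphisms of $\mathbb{R}$ that are quasi-isometries). *)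

theory Defs
  imports "HOL-Analysis.Analysis" "HOL-Algebra.Coset"
begin

text \<open>A metric space is a subset of a type of class \<open>metric_space\<close>, with the restricted distance.
  Since \<open>infdist y {} = 0\<close>, nonemptiness of the image is demanded explicitly as soon as the target
  has a point.\<close>

definition quasi_isometry ::
    "'a::metric_space set \<Rightarrow> 'b::metric_space set \<Rightarrow> ('a \<Rightarrow> 'b) \<Rightarrow> bool" where
  "quasi_isometry X Y f \<longleftrightarrow> f \<in> X \<rightarrow> Y \<and>
     (\<exists>K C. K \<ge> 1 \<and> C \<ge> 0 \<and>
        (\<forall>x1\<in>X. \<forall>x2\<in>X. 1 / K * dist x1 x2 - C \<le> dist (f x1) (f x2) \<and>
                         dist (f x1) (f x2) \<le> K * dist x1 x2 + C) \<and>
        (\<forall>y\<in>Y. f ` X \<noteq> {} \<and> infdist y (f ` X) \<le> C))"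

text \<open>Maps \<open>X \<rightarrow> X\<close> are represented by their extensional versions, so that two of them are equal
  iff they agree on \<open>X\<close>.\<close>

definition qi_maps :: "'a::metric_space set \<Rightarrow> ('a \<Rightarrow> 'a) set" where
  "qi_maps X = {f \<in> extensional X. quasi_isometry X X f}"

definition qi_rel :: "'a::metric_space set \<Rightarrow> (('a \<Rightarrow> 'a) \<times> ('a \<Rightarrow> 'a)) set" where
  "qi_rel X = {(f, g). f \<in> qi_maps X \<and> g \<in> qi_maps X \<and>
                       bdd_above ((\<lambda>x. dist (f x) (g x)) ` X)}"

text \<open>The product of two classes is the class of \<open>f \<circ> g\<close> for any representatives \<open>f\<close>, \<open>g\<close>; all
  sets in the union coincide (see \<open>QI_mult\<close> below).\<close>

definition QI :: "'a::metric_space set \<Rightarrow> ('a \<Rightarrow> 'a) set monoid" where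
  "QI X = \<lparr>carrier = qi_maps X // qi_rel X,
           monoid.mult = (\<lambda>A B. \<Union>f\<in>A. \<Union>g\<in>B. qi_rel X `` {compose X f g}),
           one = qi_rel X `` {\<lambda>x\<in>X. x}\<rparr>"

definition qi_plus_classes :: "(real \<Rightarrow> real) set set" where
  "qi_plus_classes = {qi_rel UNIV `` {f} | f. f \<in> qi_maps UNIV \<and>
     filterlim f at_top at_top \<and> filterlim f at_bot at_bot}"

definition QI_plus :: "(real \<Rightarrow> real) set monoid" where
  "QI_plus = (QI UNIV)\<lparr>carrier := qi_plus_classes\<rparr>"

text \<open>The locale \<open>simple_group\<close> of HOL-Algebra requires \<open>order G > 1\<close>, which fails for every
  infinite group because \<open>order\<close> is then \<open>0\<close>. Nontriviality is therefore stated directly.\<close>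

definition is_simple :: "('a, 'b) monoid_scheme \<Rightarrow> bool" where
  "is_simple G \<longleftrightarrow> group G \<and> carrier G \<noteq> {\<one>\<^bsub>G\<^esub>} \<and>
     (\<forall>N. N \<lhd> G \<longrightarrow> N = {\<one>\<^bsub>G\<^esub>} \<or> N = carrier G)"

section \<open>Well-definedness of the groups\<close>

lemma quasi_isometryI:
  assumes "f \<in> X \<rightarrow> Y"
    and ub: "\<And>x x'. x \<in> X \<Longrightarrow> x' \<in> X \<Longrightarrow> dist (f x) (f x') \<le> K * dist x x' + a"
    and lb: "\<And>x x'. x \<in> X \<Longrightarrow> x' \<in> X \<Longrightarrow> dist x x' \<le> L * dist (f x) (f x') + b"
    and sur: "\<And>y. y \<in> Y \<Longrightarrow> \<exists>x\<in>X. dist (f x) y \<le> c"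
  shows "quasi_isometry X Y f"
proof -
  define M where "M = max 1 (max K L)"
  define C where "C = max 0 (max a (max b c))"
  have M: "M \<ge> 1" "M \<ge> K" "M \<ge> L" and C: "C \<ge> 0" "C \<ge> a" "C \<ge> b" "C \<ge> c"
    by (auto simp: M_def C_def)
  have "dist (f x) (f x') \<le> M * dist x x' + C" if "x \<in> X" "x' \<in> X" for x x'
    using ub[OF that] mult_right_mono[OF M(2), of "dist x x'"] C by simp
  moreover have "1 / M * dist x x' - C \<le> dist (f x) (f x')" if "x \<in> X" "x' \<in> X" for x x'
  proof -
    have "dist x x' \<le> M * dist (f x) (f x') + C"
      using lb[OF that] mult_right_mono[OF M(3), of "dist (f x) (f x')"] C by simp
    also have "\<dots> \<le> M * (dist (f x) (f x') + C)"
      using M(1) C(1) mult_right_mono[of 1 M C] by (simp add: distrib_left)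
    finally show ?thesis using M(1) by (simp add: field_simps)
  qed
  moreover have "f ` X \<noteq> {} \<and> infdist y (f ` X) \<le> C" if "y \<in> Y" for y
  proof -
    from sur[OF that] obtain x where x: "x \<in> X" "dist (f x) y \<le> c" by blast
    then have "infdist y (f ` X) \<le> C"
      using C(4) by (intro infdist_le2[of "f x"]) (auto simp: dist_commute)
    with x(1) show ?thesis by blast
  qed
  ultimately show ?thesis
    unfolding quasi_isometry_def using assms(1) M(1) C(1) by blast
qed

lemma quasi_isometryE:
  assumes "quasi_isometry X Y f"
  obtains K C where "f \<in> X \<rightarrow> Y" "K \<ge> 1" "C \<ge> 0"
    "\<And>x x'. x \<in> X \<Longrightarrow> x' \<in> X \<Longrightarrow> dist (f x) (f x') \<le> K * dist x x' + C"
    "\<And>x x'. x \<in> X \<Longrightarrow> x' \<in> X \<Longrightarrow> dist x x' \<le> K * dist (f x) (f x') + C"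
    "\<And>y. y \<in> Y \<Longrightarrow> \<exists>x\<in>X. dist (f x) y \<le> C"
proof -
  from assms obtain K C where f: "f \<in> X \<rightarrow> Y" and K: "K \<ge> 1" and C: "C \<ge> 0"
    and lb: "\<And>x x'. x \<in> X \<Longrightarrow> x' \<in> X \<Longrightarrow> 1 / K * dist x x' - C \<le> dist (f x) (f x')"
    and ub: "\<And>x x'. x \<in> X \<Longrightarrow> x' \<in> X \<Longrightarrow> dist (f x) (f x') \<le> K * dist x x' + C"
    and sur: "\<And>y. y \<in> Y \<Longrightarrow> f ` X \<noteq> {} \<and> infdist y (f ` X) \<le> C"
    unfolding quasi_isometry_def by blast
  have KC: "C \<le> K * C" using K C mult_right_mono[of 1 K C] by simp
  show thesis
  proof (rule that[of K "K * C + 1"])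
    show "f \<in> X \<rightarrow> Y" "K \<ge> 1" by fact+
    show "K * C + 1 \<ge> 0" using KC C by linarith
    fix x x' assume x: "x \<in> X" "x' \<in> X"
    show "dist (f x) (f x') \<le> K * dist x x' + (K * C + 1)" using ub[OF x] KC by linarith
    have "dist x x' \<le> K * (dist (f x) (f x') + C)" using lb[OF x] K by (simp add: field_simps)
    then show "dist x x' \<le> K * dist (f x) (f x') + (K * C + 1)" by (simp add: distrib_left)
  next
    fix y assume "y \<in> Y"
    from sur[OF this] have ne: "f ` X \<noteq> {}" and le: "infdist y (f ` X) < C + 1" by auto
    then have "(INF a\<in>f ` X. dist y a) < C + 1" by (simp add: infdist_notempty)
    with ne have "\<exists>a\<in>f ` X. dist y a < C + 1" by (subst (asm) cINF_less_iff) auto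
    then obtain x where "x \<in> X" "dist y (f x) < C + 1" by blast
    then have "dist (f x) y \<le> K * C + 1" using KC by (simp add: dist_commute)
    with \<open>x \<in> X\<close> show "\<exists>x\<in>X. dist (f x) y \<le> K * C + 1" by blast
  qed
qed

lemma qi_mapsE:
  assumes "f \<in> qi_maps X"
  obtains K C where "f \<in> X \<rightarrow> X" "K \<ge> 1" "C \<ge> 0"
    "\<And>x x'. x \<in> X \<Longrightarrow> x' \<in> X \<Longrightarrow> dist (f x) (f x') \<le> K * dist x x' + C"
    "\<And>x x'. x \<in> X \<Longrightarrow> x' \<in> X \<Longrightarrow> dist x x' \<le> K * dist (f x) (f x') + C"
    "\<And>y. y \<in> X \<Longrightarrow> \<exists>x\<in>X. dist (f x) y \<le> C"
proof -
  from assms have "quasi_isometry X X f" by (simp add: qi_maps_def)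
  then show thesis by (rule quasi_isometryE) (rule that)
qed

lemma qi_rel_iff:
  "(f, g) \<in> qi_rel X \<longleftrightarrow> f \<in> qi_maps X \<and> g \<in> qi_maps X \<and> (\<exists>D. \<forall>x\<in>X. dist (f x) (g x) \<le> D)"
  by (auto simp: qi_rel_def bdd_above_def)

lemma qi_maps_closed: "f \<in> qi_maps X \<Longrightarrow> x \<in> X \<Longrightarrow> f x \<in> X"
  by (auto simp: qi_maps_def quasi_isometry_def)

lemma equiv_qi_rel: "equiv (qi_maps X) (qi_rel X)"
proof (rule equivI)
  show "refl_on (qi_maps X) (qi_rel X)" "qi_rel X \<subseteq> qi_maps X \<times> qi_maps X"
    by (auto simp: refl_on_def qi_rel_iff)
  show "sym (qi_rel X)"
    by (auto simp: sym_def qi_rel_iff dist_commute)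
  show "trans (qi_rel X)"
  proof (rule transI)
    fix f g h assume "(f, g) \<in> qi_rel X" "(g, h) \<in> qi_rel X"
    then obtain D E where *: "f \<in> qi_maps X" "h \<in> qi_maps X"
      "\<And>x. x \<in> X \<Longrightarrow> dist (f x) (g x) \<le> D" "\<And>x. x \<in> X \<Longrightarrow> dist (g x) (h x) \<le> E"
      by (auto simp: qi_rel_iff)
    have "dist (f x) (h x) \<le> D + E" if "x \<in> X" for x
      using *(3,4)[OF that] dist_triangle[of "f x" "h x" "g x"] by linarith
    with * show "(f, h) \<in> qi_rel X" unfolding qi_rel_iff by blast
  qed
qed

lemma id_in_qi_maps: "(\<lambda>x\<in>X. x) \<in> qi_maps X"
  unfolding qi_maps_def
  by (auto intro!: quasi_isometryI[where K = 1 and L = 1 and a = 0 and b = 0 and c = 0])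

lemma compose_in_qi_maps:
  assumes f: "f \<in> qi_maps X" and g: "g \<in> qi_maps X"
  shows "compose X f g \<in> qi_maps X"
proof -
  from f obtain K C where fX: "f \<in> X \<rightarrow> X" and K: "K \<ge> 1" and "C \<ge> 0" and f1:
    "\<And>x x'. x \<in> X \<Longrightarrow> x' \<in> X \<Longrightarrow> dist (f x) (f x') \<le> K * dist x x' + C"
    "\<And>x x'. x \<in> X \<Longrightarrow> x' \<in> X \<Longrightarrow> dist x x' \<le> K * dist (f x) (f x') + C"
    "\<And>y. y \<in> X \<Longrightarrow> \<exists>x\<in>X. dist (f x) y \<le> C"
    by (rule qi_mapsE) (rule that)
  from g obtain L D where gX: "g \<in> X \<rightarrow> X" and L: "L \<ge> 1" and "D \<ge> 0" and g1:
    "\<And>x x'. x \<in> X \<Longrightarrow> x' \<in> X \<Longrightarrow> dist (g x) (g x') \<le> L * dist x x' + D"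
    "\<And>x x'. x \<in> X \<Longrightarrow> x' \<in> X \<Longrightarrow> dist x x' \<le> L * dist (g x) (g x') + D"
    "\<And>y. y \<in> X \<Longrightarrow> \<exists>x\<in>X. dist (g x) y \<le> D"
    by (rule qi_mapsE) (rule that)
  have "quasi_isometry X X (compose X f g)"
  proof (rule quasi_isometryI[where K = "K * L" and L = "L * K" and a = "K * D + C"
        and b = "L * C + D" and c = "K * D + C + C"])
    show "compose X f g \<in> X \<rightarrow> X" using fX gX by (auto simp: compose_def)
    fix x x' assume x: "x \<in> X" "x' \<in> X"
    then have gx: "g x \<in> X" "g x' \<in> X" using gX by auto
    have "dist (f (g x)) (f (g x')) \<le> K * (L * dist x x' + D) + C"
      using f1(1)[OF gx] mult_left_mono[OF g1(1)[OF x], of K] K by linarith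
    then show "dist (compose X f g x) (compose X f g x') \<le> K * L * dist x x' + (K * D + C)"
      using x by (simp add: compose_eq algebra_simps)
    have "dist x x' \<le> L * (K * dist (f (g x)) (f (g x')) + C) + D"
      using g1(2)[OF x] mult_left_mono[OF f1(2)[OF gx], of L] L by linarith
    then show "dist x x' \<le> L * K * dist (compose X f g x) (compose X f g x') + (L * C + D)"
      using x by (simp add: compose_eq algebra_simps)
  next
    fix y assume "y \<in> X"
    then obtain z where z: "z \<in> X" "dist (f z) y \<le> C" using f1(3) by blast
    then obtain x where x: "x \<in> X" "dist (g x) z \<le> D" using g1(3) by blast
    have "dist (f (g x)) (f z) \<le> K * D + C"
      using f1(1)[OF qi_maps_closed[OF g x(1)] z(1)] mult_left_mono[OF x(2), of K] K by linarith
    then have "dist (f (g x)) y \<le> K * D + C + C"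
      using z(2) dist_triangle[of "f (g x)" y "f z"] by linarith
    with x(1) show "\<exists>x\<in>X. dist (compose X f g x) y \<le> K * D + C + C"
      by (auto simp: compose_eq)
  qed
  then show ?thesis by (simp add: qi_maps_def compose_extensional)
qed

lemma compose_qi_rel:
  assumes "(f, f') \<in> qi_rel X" "(g, g') \<in> qi_rel X"
  shows "(compose X f g, compose X f' g') \<in> qi_rel X"
proof -
  from assms obtain D E where *: "f \<in> qi_maps X" "f' \<in> qi_maps X" "g \<in> qi_maps X" "g' \<in> qi_maps X"
    "\<And>x. x \<in> X \<Longrightarrow> dist (f x) (f' x) \<le> D" "\<And>x. x \<in> X \<Longrightarrow> dist (g x) (g' x) \<le> E"
    by (auto simp: qi_rel_iff)
  from *(1) obtain K C where K: "K \<ge> 1" and f1: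
    "\<And>x x'. x \<in> X \<Longrightarrow> x' \<in> X \<Longrightarrow> dist (f x) (f x') \<le> K * dist x x' + C"
    by (rule qi_mapsE) (rule that)
  have "dist (compose X f g x) (compose X f' g' x) \<le> K * E + C + D" if x: "x \<in> X" for x
  proof -
    have gx: "g x \<in> X" "g' x \<in> X" using x *(3,4) by (auto intro: qi_maps_closed)
    have "dist (f (g x)) (f (g' x)) \<le> K * E + C"
      using f1[OF gx] mult_left_mono[OF *(6)[OF x], of K] K by linarith
    then show ?thesis
      using *(5)[OF gx(2)] dist_triangle[of "f (g x)" "f' (g' x)" "f (g' x)"] x
      by (simp add: compose_eq)
  qed
  with * show ?thesis unfolding qi_rel_iff by (blast intro: compose_in_qi_maps)
qed

lemma quasi_inverse:
  assumes f: "f \<in> qi_maps X"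
  obtains g where "g \<in> qi_maps X" "(compose X g f, \<lambda>x\<in>X. x) \<in> qi_rel X"
proof -
  from f obtain K C where fX: "f \<in> X \<rightarrow> X" and K: "K \<ge> 1" and "C \<ge> 0" and f1:
    "\<And>x x'. x \<in> X \<Longrightarrow> x' \<in> X \<Longrightarrow> dist (f x) (f x') \<le> K * dist x x' + C"
    "\<And>x x'. x \<in> X \<Longrightarrow> x' \<in> X \<Longrightarrow> dist x x' \<le> K * dist (f x) (f x') + C"
    "\<And>y. y \<in> X \<Longrightarrow> \<exists>x\<in>X. dist (f x) y \<le> C"
    by (rule qi_mapsE) (rule that)
  from f1(3) obtain g0 where g0: "\<And>y. y \<in> X \<Longrightarrow> g0 y \<in> X \<and> dist (f (g0 y)) y \<le> C" by metis
  define g where "g = restrict g0 X"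
  have g: "g y \<in> X" "dist (f (g y)) y \<le> C" if "y \<in> X" for y
    using g0[OF that] that by (auto simp: g_def)
  have gf: "dist (g (f x)) x \<le> K * C + C" if x: "x \<in> X" for x
  proof -
    have fx: "f x \<in> X" using fX x by auto
    show ?thesis
      using f1(2)[OF g(1)[OF fx] x] mult_left_mono[OF g(2)[OF fx], of K] K by linarith
  qed
  have "quasi_isometry X X g"
  proof (rule quasi_isometryI[where K = K and L = K and a = "K * (2 * C) + C"
        and b = "C + 2 * C" and c = "K * C + C"])
    show "g \<in> X \<rightarrow> X" using g by auto
    fix x x' assume x: "x \<in> X" "x' \<in> X"
    have tri: "dist (f (g x)) (f (g x')) \<le> dist x x' + 2 * C"
              "dist x x' \<le> dist (f (g x)) (f (g x')) + 2 * C"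
      using g(2)[OF x(1)] g(2)[OF x(2)]
        dist_triangle[of "f (g x)" "f (g x')" x] dist_triangle[of x "f (g x')" x']
        dist_triangle[of x x' "f (g x)"] dist_triangle[of "f (g x)" x' "f (g x')"]
      by (auto simp: dist_commute)
    show "dist (g x) (g x') \<le> K * dist x x' + (K * (2 * C) + C)"
      using f1(2)[OF g(1)[OF x(1)] g(1)[OF x(2)]] mult_left_mono[OF tri(1), of K] K
      by (simp add: distrib_left)
    show "dist x x' \<le> K * dist (g x) (g x') + (C + 2 * C)"
      using f1(1)[OF g(1)[OF x(1)] g(1)[OF x(2)]] tri(2) by linarith
  next
    fix y assume "y \<in> X"
    then show "\<exists>x\<in>X. dist (g x) y \<le> K * C + C" using gf fX by blast
  qed
  then have "g \<in> qi_maps X" by (simp add: qi_maps_def g_def)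
  moreover from this f have "(compose X g f, \<lambda>x\<in>X. x) \<in> qi_rel X"
    unfolding qi_rel_iff using gf
    by (auto simp: compose_eq id_in_qi_maps intro: compose_in_qi_maps)
  ultimately show thesis by (rule that)
qed

lemma QI_mult:
  assumes f: "f \<in> qi_maps X" and g: "g \<in> qi_maps X"
  shows "qi_rel X `` {f} \<otimes>\<^bsub>QI X\<^esub> qi_rel X `` {g} = qi_rel X `` {compose X f g}"
proof -
  have "qi_rel X `` {compose X f' g'} = qi_rel X `` {compose X f g}"
    if "(f, f') \<in> qi_rel X" "(g, g') \<in> qi_rel X" for f' g'
    using equiv_class_eq[OF equiv_qi_rel compose_qi_rel[OF that]] by simp
  then have "(\<Union>f'\<in>qi_rel X `` {f}. \<Union>g'\<in>qi_rel X `` {g}. qi_rel X `` {compose X f' g'}) =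
      (\<Union>f'\<in>qi_rel X `` {f}. \<Union>g'\<in>qi_rel X `` {g}. qi_rel X `` {compose X f g})"
    by (intro SUP_cong refl) (simp add: Image_singleton_iff)
  also have "\<dots> = qi_rel X `` {compose X f g}"
    using equiv_class_self[OF equiv_qi_rel f] equiv_class_self[OF equiv_qi_rel g] by blast
  finally show ?thesis by (simp add: QI_def)
qed

lemma QI_one: "\<one>\<^bsub>QI X\<^esub> = qi_rel X `` {\<lambda>x\<in>X. x}"
  by (simp add: QI_def)

lemma QI_carrierE:
  assumes "A \<in> carrier (QI X)"
  obtains f where "f \<in> qi_maps X" "A = qi_rel X `` {f}"
  using assms by (auto simp: QI_def elim: quotientE)

lemma QI_carrierI: "f \<in> qi_maps X \<Longrightarrow> qi_rel X `` {f} \<in> carrier (QI X)"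
  by (auto simp: QI_def intro: quotientI)

theorem group_QI: "group (QI X)"
proof (rule groupI)
  show "\<one>\<^bsub>QI X\<^esub> \<in> carrier (QI X)"
    by (simp add: QI_one QI_carrierI id_in_qi_maps)
  fix A assume "A \<in> carrier (QI X)"
  then obtain f where f: "f \<in> qi_maps X" "A = qi_rel X `` {f}" by (rule QI_carrierE)
  have "compose X (\<lambda>x\<in>X. x) f = f"
    using f(1) by (intro Id_compose) (auto simp: qi_maps_def quasi_isometry_def)
  then show "\<one>\<^bsub>QI X\<^esub> \<otimes>\<^bsub>QI X\<^esub> A = A"
    using f by (simp add: QI_one QI_mult id_in_qi_maps)
  obtain g where g: "g \<in> qi_maps X" "(compose X g f, \<lambda>x\<in>X. x) \<in> qi_rel X"
    using quasi_inverse[OF f(1)] .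
  then have "qi_rel X `` {g} \<otimes>\<^bsub>QI X\<^esub> A = \<one>\<^bsub>QI X\<^esub>"
    using equiv_class_eq[OF equiv_qi_rel g(2)] f by (simp add: QI_one QI_mult)
  with g(1) show "\<exists>B\<in>carrier (QI X). B \<otimes>\<^bsub>QI X\<^esub> A = \<one>\<^bsub>QI X\<^esub>" by (blast intro: QI_carrierI)
  fix B assume "B \<in> carrier (QI X)"
  then obtain g where g: "g \<in> qi_maps X" "B = qi_rel X `` {g}" by (rule QI_carrierE)
  show "A \<otimes>\<^bsub>QI X\<^esub> B \<in> carrier (QI X)"
    using f g by (simp add: QI_mult QI_carrierI compose_in_qi_maps)
  fix D assume "D \<in> carrier (QI X)"
  then obtain h where h: "h \<in> qi_maps X" "D = qi_rel X `` {h}" by (rule QI_carrierE)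
  have "compose X (compose X f g) h = compose X f (compose X g h)"
    using h(1) by (auto simp: compose_def fun_eq_iff intro: qi_maps_closed)
  then show "A \<otimes>\<^bsub>QI X\<^esub> B \<otimes>\<^bsub>QI X\<^esub> D = A \<otimes>\<^bsub>QI X\<^esub> (B \<otimes>\<^bsub>QI X\<^esub> D)"
    using f g h by (simp add: QI_mult compose_in_qi_maps)
qed

lemma orientation_qi_rel:
  fixes f g :: "real \<Rightarrow> real"
  assumes "(f, g) \<in> qi_rel UNIV" "filterlim f at_top at_top" "filterlim f at_bot at_bot"
  shows "filterlim g at_top at_top" "filterlim g at_bot at_bot"
proof -
  from assms(1) obtain D where D: "\<And>x. \<bar>f x - g x\<bar> \<le> D"
    by (auto simp: qi_rel_iff dist_real_def)
  have "eventually (\<lambda>x. Z \<le> g x) at_top" for Z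
  proof -
    from assms(2) have "eventually (\<lambda>x. Z + D \<le> f x) at_top" by (simp add: filterlim_at_top)
    then show ?thesis
    proof eventually_elim
      case (elim x) then show ?case using D[of x] by linarith
    qed
  qed
  then show "filterlim g at_top at_top" by (simp add: filterlim_at_top)
  have "eventually (\<lambda>x. g x \<le> Z) at_bot" for Z
  proof -
    from assms(3) have "eventually (\<lambda>x. f x \<le> Z - D) at_bot" by (simp add: filterlim_at_bot)
    then show ?thesis
    proof eventually_elim
      case (elim x) then show ?case using D[of x] by linarith
    qed
  qed
  then show "filterlim g at_bot at_bot" by (simp add: filterlim_at_bot)
qed

lemma orientation_right_inverse:
  fixes f g :: "real \<Rightarrow> real"
  assumes f: "f \<in> qi_maps UNIV" "filterlim f at_top at_top" "filterlim f at_bot at_bot"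
    and fg: "(compose UNIV f g, \<lambda>x\<in>UNIV. x) \<in> qi_rel UNIV"
  shows "filterlim g at_top at_top" "filterlim g at_bot at_bot"
proof -
  from fg obtain D where D: "\<And>x. \<bar>f (g x) - x\<bar> \<le> D"
    by (auto simp: qi_rel_iff dist_real_def compose_eq)
  from f(1) obtain K C where K: "K \<ge> 1" and
    ub0: "\<And>x x'. x \<in> UNIV \<Longrightarrow> x' \<in> UNIV \<Longrightarrow> dist (f x) (f x') \<le> K * dist x x' + C"
    by (rule qi_mapsE) (rule that)
  have ub: "\<bar>f x - f x'\<bar> \<le> K * \<bar>x - x'\<bar> + C" for x x'
    using ub0[of x x'] by (simp add: dist_real_def)
  have ub': "\<bar>f x - f x'\<bar> \<le> K * M + C" if "\<bar>x - x'\<bar> \<le> M" for x x' M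
    using ub[of x x'] mult_left_mono[OF that, of K] K by linarith
  have "eventually (\<lambda>y. M \<le> g y) at_top" for M
  proof -
    from f(3) obtain N where N: "\<And>x. x \<le> N \<Longrightarrow> f x \<le> 0"
      by (auto simp: filterlim_at_bot eventually_at_bot_linorder)
    define R where "R = max 0 (f N + K * \<bar>M - N\<bar> + C)"
    have R: "f x \<le> R" if "x \<le> M" for x
    proof (cases "x \<le> N")
      case True then show ?thesis using N[of x] by (simp add: R_def)
    next
      case False
      then have "\<bar>x - N\<bar> \<le> \<bar>M - N\<bar>" using that by linarith
      from ub'[OF this] show ?thesis unfolding R_def by linarith
    qed
    have "M \<le> g y" if "R + D < y" for y
      using R[of "g y"] D[of y] that by linarith
    then show ?thesis unfolding eventually_at_top_dense by blast
  qed
  then show "filterlim g at_top at_top" by (simp add: filterlim_at_top)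
  have "eventually (\<lambda>y. g y \<le> M) at_bot" for M
  proof -
    from f(2) obtain N where N: "\<And>x. N \<le> x \<Longrightarrow> 0 \<le> f x"
      by (auto simp: filterlim_at_top eventually_at_top_linorder)
    define R where "R = min 0 (f N - K * \<bar>M - N\<bar> - C)"
    have R: "R \<le> f x" if "M \<le> x" for x
    proof (cases "N \<le> x")
      case True then show ?thesis using N[of x] by (simp add: R_def)
    next
      case False
      then have "\<bar>x - N\<bar> \<le> \<bar>M - N\<bar>" using that by linarith
      from ub'[OF this] show ?thesis unfolding R_def by linarith
    qed
    have "g y \<le> M" if "y < R - D" for y
      using R[of "g y"] D[of y] that by linarith
    then show ?thesis unfolding eventually_at_bot_dense by blast
  qed
  then show "filterlim g at_bot at_bot" by (simp add: filterlim_at_bot)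
qed

theorem subgroup_qi_plus: "subgroup qi_plus_classes (QI (UNIV :: real set))"
proof -
  interpret Q: group "QI (UNIV :: real set)" by (rule group_QI)
  show ?thesis
  proof
    show sub: "qi_plus_classes \<subseteq> carrier (QI UNIV)"
      by (auto simp: qi_plus_classes_def QI_carrierI)
    have "(\<lambda>x\<in>UNIV. x) = (\<lambda>x::real. x)" by auto
    then show "\<one>\<^bsub>QI UNIV\<^esub> \<in> qi_plus_classes"
      unfolding qi_plus_classes_def QI_one using id_in_qi_maps[of "UNIV :: real set"]
      by (auto simp: filterlim_ident)
    fix A assume A: "A \<in> qi_plus_classes"
    then obtain f where f: "A = qi_rel UNIV `` {f}" "f \<in> qi_maps UNIV"
      "filterlim f at_top at_top" "filterlim f at_bot at_bot"
      by (auto simp: qi_plus_classes_def)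
    have "inv\<^bsub>QI UNIV\<^esub> A \<in> carrier (QI UNIV)" using A sub by blast
    then obtain g where g: "g \<in> qi_maps UNIV" "inv\<^bsub>QI UNIV\<^esub> A = qi_rel UNIV `` {g}"
      by (rule QI_carrierE)
    have "A \<otimes>\<^bsub>QI UNIV\<^esub> inv\<^bsub>QI UNIV\<^esub> A = \<one>\<^bsub>QI UNIV\<^esub>" using A sub by (auto intro: Q.r_inv)
    then have "qi_rel UNIV `` {compose UNIV f g} = qi_rel UNIV `` {\<lambda>x\<in>UNIV. x}"
      using f g by (simp add: QI_mult QI_one)
    then have "(compose UNIV f g, \<lambda>x\<in>UNIV. x) \<in> qi_rel UNIV"
      by (rule eq_equiv_class[OF _ equiv_qi_rel id_in_qi_maps])
    from orientation_right_inverse[OF f(2-4) this] g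
    show "inv\<^bsub>QI UNIV\<^esub> A \<in> qi_plus_classes" by (auto simp: qi_plus_classes_def)
    fix B assume "B \<in> qi_plus_classes"
    then obtain h where h: "B = qi_rel UNIV `` {h}" "h \<in> qi_maps UNIV"
      "filterlim h at_top at_top" "filterlim h at_bot at_bot"
      by (auto simp: qi_plus_classes_def)
    have "compose UNIV f h = (\<lambda>x. f (h x))" by (auto simp: compose_def)
    then have "filterlim (compose UNIV f h) at_top at_top" "filterlim (compose UNIV f h) at_bot at_bot"
      using f h by (auto intro: filterlim_compose)
    then show "A \<otimes>\<^bsub>QI UNIV\<^esub> B \<in> qi_plus_classes"
      using f h compose_in_qi_maps[OF f(2) h(2)] by (auto simp: QI_mult qi_plus_classes_def)
  qed
qed

theorem group_QI_plus: "group QI_plus"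
  unfolding QI_plus_def
  by (rule group.subgroup_imp_group[OF group_QI subgroup_qi_plus])

end

theory Submission
  imports Defs
begin

text \<open>
  The displacement \<open>dist (f x) x\<close> of a quasi-isometry \<open>f : X \<rightarrow> X\<close> is determined by the class of
  \<open>f\<close> up to a bounded error. Call it sublinear if it is \<open>o(dist x p)\<close> up to a constant, for a
  base point \<open>p\<close>. Quasi-isometries distort the distance to \<open>p\<close> at most linearly, and distances
  between two points at most by a factor and an additive constant. Neither affects sublinearity,
  so the classes of sublinear displacement are closed under products and inverses and, because
  the displacement of \<open>g \<circ> f \<circ> g\<inverse>\<close> at \<open>x\<close> is controlled by that of \<open>f\<close> at \<open>g\<inverse> x\<close>, also under
  conjugation. They form a normal subgroup of \<open>QI X\<close> for every metric space \<open>X\<close>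
  (\<open>normal_sublinear_classes\<close>), and intersecting with a subgroup \<open>H\<close> gives a normal subgroup of \<open>H\<close>.

  On the line and on the ray this normal subgroup lies strictly between the trivial and the full
  group: \<open>x \<mapsto> x + sqrt x\<close> has unbounded but sublinear displacement, while \<open>x \<mapsto> 2 * x\<close> has
  linear displacement. Since both maps preserve the orientation of the line, the same
  subgroup settles \<open>QI_plus\<close>.
\<close>

section \<open>Sublinear functions on a metric space\<close>

text \<open>The additive constant may depend on the slope \<open>e\<close>. With constants instead of a limit of
  \<open>u x / dist x p\<close> nothing has to be said about bounded spaces or about points near \<open>p\<close>, and the
  closure properties become direct estimates.\<close>

definition sublinear_on :: "'a::metric_space set \<Rightarrow> 'a \<Rightarrow> ('a \<Rightarrow> real) \<Rightarrow> bool" where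
  "sublinear_on X p u \<longleftrightarrow> (\<forall>e>0. \<exists>D. \<forall>x\<in>X. u x \<le> e * dist x p + D)"

lemma sublinear_onD:
  assumes "sublinear_on X p u" "e > 0"
  obtains D where "\<And>x. x \<in> X \<Longrightarrow> u x \<le> e * dist x p + D"
  using assms unfolding sublinear_on_def by blast

lemma sublinear_on_mono:
  assumes "sublinear_on X p u" "\<And>x. x \<in> X \<Longrightarrow> v x \<le> u x"
  shows "sublinear_on X p v"
  using assms unfolding sublinear_on_def by (meson order_trans)

lemma sublinear_on_const: "sublinear_on X p (\<lambda>_. c)"
  unfolding sublinear_on_def by (intro allI impI exI[of _ c]) auto

lemma sublinear_on_add:
  assumes "sublinear_on X p u" "sublinear_on X p v"
  shows "sublinear_on X p (\<lambda>x. u x + v x)"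
  unfolding sublinear_on_def
proof (intro allI impI)
  fix e :: real assume "e > 0"
  then have e: "e / 2 > 0" by simp
  obtain D where D: "\<And>x. x \<in> X \<Longrightarrow> u x \<le> e / 2 * dist x p + D"
    by (rule sublinear_onD[OF assms(1) e]) (rule that)
  obtain E where E: "\<And>x. x \<in> X \<Longrightarrow> v x \<le> e / 2 * dist x p + E"
    by (rule sublinear_onD[OF assms(2) e]) (rule that)
  have "u x + v x \<le> e * dist x p + (D + E)" if "x \<in> X" for x
    using D[OF that] E[OF that] by simp
  then show "\<exists>D. \<forall>x\<in>X. u x + v x \<le> e * dist x p + D" by blast
qed

lemma sublinear_on_cmult:
  assumes "sublinear_on X p u" "K > 0"
  shows "sublinear_on X p (\<lambda>x. K * u x)"
  unfolding sublinear_on_def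
proof (intro allI impI)
  fix e :: real assume "e > 0"
  with assms(2) have e: "e / K > 0" by simp
  obtain D where D: "\<And>x. x \<in> X \<Longrightarrow> u x \<le> e / K * dist x p + D"
    by (rule sublinear_onD[OF assms(1) e]) (rule that)
  have "K * u x \<le> e * dist x p + K * D" if "x \<in> X" for x
    using mult_left_mono[OF D[OF that], of K] assms(2) by (simp add: distrib_left)
  then show "\<exists>D. \<forall>x\<in>X. K * u x \<le> e * dist x p + D" by blast
qed

text \<open>A quasi-isometry \<open>h\<close> satisfies \<open>dist (h x) p \<le> K * dist x p + M\<close> for a suitable \<open>M\<close>, so a
  slope \<open>e / K\<close> for \<open>u\<close> yields a slope \<open>e\<close> for \<open>u \<circ> h\<close>.\<close>

lemma sublinear_on_compose:
  assumes u: "sublinear_on X p u" and h: "h \<in> qi_maps X"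
  shows "sublinear_on X p (\<lambda>x. u (h x))"
  unfolding sublinear_on_def
proof (intro allI impI)
  fix e :: real assume "e > 0"
  from h obtain K C where hX: "h \<in> X \<rightarrow> X" and K: "K \<ge> 1" and h1:
    "\<And>x x'. x \<in> X \<Longrightarrow> x' \<in> X \<Longrightarrow> dist (h x) (h x') \<le> K * dist x x' + C"
    by (rule qi_mapsE) (rule that)
  obtain M where M: "\<And>x. x \<in> X \<Longrightarrow> dist (h x) p \<le> K * dist x p + M"
  proof (cases "X = {}")
    case True
    then show ?thesis using that by simp
  next
    case False
    then obtain x0 where x0: "x0 \<in> X" by blast
    have "dist (h x) p \<le> K * dist x p + (K * dist p x0 + C + dist (h x0) p)" if x: "x \<in> X" for x
    proof -
      have "K * dist x x0 \<le> K * (dist x p + dist p x0)"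
        using K by (intro mult_left_mono dist_triangle) simp
      then show ?thesis
        using h1[OF x x0] dist_triangle[of "h x" p "h x0"] by (simp add: distrib_left)
    qed
    then show ?thesis by (rule that)
  qed
  from \<open>e > 0\<close> K have e: "e / K > 0" by simp
  obtain D where D: "\<And>x. x \<in> X \<Longrightarrow> u x \<le> e / K * dist x p + D"
    by (rule sublinear_onD[OF u e]) (rule that)
  have "u (h x) \<le> e * dist x p + (e / K * M + D)" if x: "x \<in> X" for x
  proof -
    have "h x \<in> X" using hX x by auto
    then have "u (h x) \<le> e / K * (K * dist x p + M) + D"
      using D[of "h x"] mult_left_mono[OF M[OF x], of "e / K"] e by linarith
    then show ?thesis using K by (simp add: distrib_left)
  qed
  then show "\<exists>D. \<forall>x\<in>X. u (h x) \<le> e * dist x p + D" by blast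
qed

section \<open>The normal subgroup of classes with sublinear displacement\<close>

definition sublinear_classes :: "'a::metric_space set \<Rightarrow> 'a \<Rightarrow> ('a \<Rightarrow> 'a) set set" where
  "sublinear_classes X p =
     {qi_rel X `` {f} | f. f \<in> qi_maps X \<and> sublinear_on X p (\<lambda>x. dist (f x) x)}"

lemma sublinear_displacement_qi_rel:
  assumes "(f, g) \<in> qi_rel X" "sublinear_on X p (\<lambda>x. dist (f x) x)"
  shows "sublinear_on X p (\<lambda>x. dist (g x) x)"
proof -
  from assms(1) obtain D where D: "\<And>x. x \<in> X \<Longrightarrow> dist (f x) (g x) \<le> D"
    by (auto simp: qi_rel_iff)
  have "dist (g x) x \<le> D + dist (f x) x" if "x \<in> X" for x
    using D[OF that] dist_triangle[of "g x" x "f x"] by (simp add: dist_commute)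
  with sublinear_on_add[OF sublinear_on_const assms(2)] show ?thesis
    by (rule sublinear_on_mono)
qed

lemma qi_class_eq_iff:
  assumes "f \<in> qi_maps X" "g \<in> qi_maps X"
  shows "qi_rel X `` {f} = qi_rel X `` {g} \<longleftrightarrow> (f, g) \<in> qi_rel X"
  using assms by (intro eq_equiv_class_iff[OF equiv_qi_rel])

lemma mem_sublinear_classes_iff:
  assumes "f \<in> qi_maps X"
  shows "qi_rel X `` {f} \<in> sublinear_classes X p \<longleftrightarrow> sublinear_on X p (\<lambda>x. dist (f x) x)"
proof
  assume "qi_rel X `` {f} \<in> sublinear_classes X p"
  then obtain g where g: "qi_rel X `` {f} = qi_rel X `` {g}" "g \<in> qi_maps X"
    "sublinear_on X p (\<lambda>x. dist (g x) x)"
    unfolding sublinear_classes_def by blast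
  then have "(g, f) \<in> qi_rel X" using qi_class_eq_iff[OF g(2) assms] by simp
  then show "sublinear_on X p (\<lambda>x. dist (f x) x)"
    using g(3) by (rule sublinear_displacement_qi_rel)
next
  assume "sublinear_on X p (\<lambda>x. dist (f x) x)"
  then show "qi_rel X `` {f} \<in> sublinear_classes X p"
    unfolding sublinear_classes_def using assms by blast
qed

lemma QI_inv_representative:
  assumes f: "f \<in> qi_maps X"
  obtains g where "g \<in> qi_maps X" "inv\<^bsub>QI X\<^esub> (qi_rel X `` {f}) = qi_rel X `` {g}"
    "(compose X f g, \<lambda>x\<in>X. x) \<in> qi_rel X"
proof -
  interpret Q: group "QI X" by (rule group_QI)
  have F: "qi_rel X `` {f} \<in> carrier (QI X)" using f by (rule QI_carrierI)
  obtain g where g: "g \<in> qi_maps X" "inv\<^bsub>QI X\<^esub> (qi_rel X `` {f}) = qi_rel X `` {g}"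
    by (rule QI_carrierE[OF Q.inv_closed[OF F]])
  have "qi_rel X `` {compose X f g} = qi_rel X `` {\<lambda>x\<in>X. x}"
    using Q.r_inv[OF F] f g by (simp add: QI_mult QI_one)
  then have "(compose X f g, \<lambda>x\<in>X. x) \<in> qi_rel X"
    by (rule eq_equiv_class[OF _ equiv_qi_rel id_in_qi_maps])
  with g show thesis by (rule that)
qed

lemma sublinear_displacement_compose:
  assumes f: "sublinear_on X p (\<lambda>x. dist (f x) x)"
    and g: "g \<in> qi_maps X" "sublinear_on X p (\<lambda>x. dist (g x) x)"
  shows "sublinear_on X p (\<lambda>x. dist (compose X f g x) x)"
proof (rule sublinear_on_mono[OF sublinear_on_add[OF sublinear_on_compose[OF f g(1)] g(2)]])
  fix x assume "x \<in> X"
  then show "dist (compose X f g x) x \<le> dist (f (g x)) (g x) + dist (g x) x"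
    by (simp add: compose_eq dist_triangle)
qed

text \<open>Since \<open>f (g x)\<close> is boundedly close to \<open>x\<close>, moving \<open>x\<close> by \<open>g\<close> costs up to a constant what
  moving \<open>g x\<close> by \<open>f\<close> costs.\<close>

lemma sublinear_displacement_right_inverse:
  assumes f: "sublinear_on X p (\<lambda>x. dist (f x) x)"
    and g: "g \<in> qi_maps X" and fg: "(compose X f g, \<lambda>x\<in>X. x) \<in> qi_rel X"
  shows "sublinear_on X p (\<lambda>x. dist (g x) x)"
proof -
  from fg obtain B where B: "\<And>x. x \<in> X \<Longrightarrow> dist (f (g x)) x \<le> B"
    by (auto simp: qi_rel_iff compose_eq)
  show ?thesis
  proof (rule sublinear_on_mono[OF sublinear_on_add[OF sublinear_on_compose[OF f g]
          sublinear_on_const]])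
    fix x assume "x \<in> X"
    from B[OF this] show "dist (g x) x \<le> dist (f (g x)) (g x) + B"
      using dist_triangle[of "g x" x "f (g x)"] by (simp add: dist_commute)
  qed
qed

text \<open>Compare \<open>g (f (g' x))\<close> with \<open>g (g' x)\<close>, which is boundedly close to \<open>x\<close>: their distance is at
  most \<open>K\<close> times the displacement of \<open>f\<close> at \<open>g' x\<close>, plus a constant.\<close>

lemma sublinear_displacement_conjugate:
  assumes f: "f \<in> qi_maps X" "sublinear_on X p (\<lambda>x. dist (f x) x)"
    and g: "g \<in> qi_maps X" and g': "g' \<in> qi_maps X"
    and gg': "(compose X g g', \<lambda>x\<in>X. x) \<in> qi_rel X"
  shows "sublinear_on X p (\<lambda>x. dist (compose X (compose X g f) g' x) x)"
proof -
  from gg' obtain B where B: "\<And>x. x \<in> X \<Longrightarrow> dist (g (g' x)) x \<le> B"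
    by (auto simp: qi_rel_iff compose_eq)
  from g obtain K C where K: "K \<ge> 1" and g1:
    "\<And>x x'. x \<in> X \<Longrightarrow> x' \<in> X \<Longrightarrow> dist (g x) (g x') \<le> K * dist x x' + C"
    by (rule qi_mapsE) (rule that)
  from K have "K > 0" by simp
  show ?thesis
  proof (rule sublinear_on_mono[OF sublinear_on_add[OF
          sublinear_on_cmult[OF sublinear_on_compose[OF f(2) g'] \<open>K > 0\<close>] sublinear_on_const]])
    fix x assume x: "x \<in> X"
    have y: "g' x \<in> X" "f (g' x) \<in> X" using x f(1) g' by (auto intro: qi_maps_closed)
    have "dist (g (f (g' x))) x \<le> K * dist (f (g' x)) (g' x) + (C + B)"
      using g1[OF y(2) y(1)] B[OF x] dist_triangle[of "g (f (g' x))" x "g (g' x)"] by linarith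
    with x y show "dist (compose X (compose X g f) g' x) x \<le> K * dist (f (g' x)) (g' x) + (C + B)"
      by (simp add: compose_eq)
  qed
qed

theorem normal_sublinear_classes: "sublinear_classes X p \<lhd> QI X"
proof -
  interpret Q: group "QI X" by (rule group_QI)
  have "subgroup (sublinear_classes X p) (QI X)"
  proof
    show "sublinear_classes X p \<subseteq> carrier (QI X)"
      by (auto simp: sublinear_classes_def QI_carrierI)
    have "sublinear_on X p (\<lambda>x. dist ((\<lambda>x\<in>X. x) x) x)"
      by (rule sublinear_on_mono[OF sublinear_on_const[of _ _ 0]]) simp
    then show "\<one>\<^bsub>QI X\<^esub> \<in> sublinear_classes X p"
      by (simp add: QI_one mem_sublinear_classes_iff id_in_qi_maps)
    fix A assume "A \<in> sublinear_classes X p"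
    then obtain f where f: "A = qi_rel X `` {f}" "f \<in> qi_maps X"
      "sublinear_on X p (\<lambda>x. dist (f x) x)"
      by (auto simp: sublinear_classes_def)
    obtain g where "g \<in> qi_maps X" "inv\<^bsub>QI X\<^esub> A = qi_rel X `` {g}"
      "(compose X f g, \<lambda>x\<in>X. x) \<in> qi_rel X"
      using QI_inv_representative[OF f(2)] f(1) by blast
    then show "inv\<^bsub>QI X\<^esub> A \<in> sublinear_classes X p"
      using sublinear_displacement_right_inverse[OF f(3)] by (simp add: mem_sublinear_classes_iff)
    fix B assume "B \<in> sublinear_classes X p"
    then obtain h where "B = qi_rel X `` {h}" "h \<in> qi_maps X"
      "sublinear_on X p (\<lambda>x. dist (h x) x)"
      by (auto simp: sublinear_classes_def)
    then show "A \<otimes>\<^bsub>QI X\<^esub> B \<in> sublinear_classes X p"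
      using f sublinear_displacement_compose[OF f(3)]
      by (simp add: QI_mult mem_sublinear_classes_iff compose_in_qi_maps)
  qed
  moreover have "G \<otimes>\<^bsub>QI X\<^esub> A \<otimes>\<^bsub>QI X\<^esub> inv\<^bsub>QI X\<^esub> G \<in> sublinear_classes X p"
    if G: "G \<in> carrier (QI X)" and A: "A \<in> sublinear_classes X p" for G A
  proof -
    from A obtain f where f: "A = qi_rel X `` {f}" "f \<in> qi_maps X"
      "sublinear_on X p (\<lambda>x. dist (f x) x)"
      by (auto simp: sublinear_classes_def)
    from G obtain g where g: "g \<in> qi_maps X" "G = qi_rel X `` {g}" by (rule QI_carrierE)
    obtain g' where g': "g' \<in> qi_maps X" "inv\<^bsub>QI X\<^esub> G = qi_rel X `` {g'}"
      "(compose X g g', \<lambda>x\<in>X. x) \<in> qi_rel X"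
      using QI_inv_representative[OF g(1)] g(2) by blast
    show ?thesis
      using sublinear_displacement_conjugate[OF f(2,3) g(1) g'(1,3)] f g g'
      by (simp add: QI_mult mem_sublinear_classes_iff compose_in_qi_maps)
  qed
  ultimately show ?thesis by (simp add: Q.normal_inv_iff)
qed

text \<open>The map \<open>f\<close> shows that the normal subgroup of \<open>H\<close> is nontrivial, and \<open>g\<close> that it is proper.\<close>

lemma not_simple_if_sublinear_and_not_sublinear:
  assumes H: "subgroup H (QI X)"
    and f: "f \<in> qi_maps X" "qi_rel X `` {f} \<in> H" "sublinear_on X p (\<lambda>x. dist (f x) x)"
      "(f, \<lambda>x\<in>X. x) \<notin> qi_rel X"
    and g: "g \<in> qi_maps X" "qi_rel X `` {g} \<in> H" "\<not> sublinear_on X p (\<lambda>x. dist (g x) x)"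
  shows "\<not> is_simple ((QI X)\<lparr>carrier := H\<rparr>)"
proof -
  have N: "H \<inter> sublinear_classes X p \<lhd> (QI X)\<lparr>carrier := H\<rparr>"
    using group.normal_Int_subgroup[OF group_QI H normal_sublinear_classes[of X p]]
    by (simp add: Int_commute)
  have F: "qi_rel X `` {f} \<in> H \<inter> sublinear_classes X p"
    using f by (simp add: mem_sublinear_classes_iff)
  have "qi_rel X `` {f} \<noteq> \<one>\<^bsub>QI X\<^esub>"
    using f by (simp add: QI_one qi_class_eq_iff id_in_qi_maps)
  with F have nontrivial: "H \<inter> sublinear_classes X p \<noteq> {\<one>\<^bsub>QI X\<^esub>}" by (metis singletonD)
  have "qi_rel X `` {g} \<notin> H \<inter> sublinear_classes X p"
    using g by (simp add: mem_sublinear_classes_iff)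
  with g(2) have proper: "H \<inter> sublinear_classes X p \<noteq> H" by metis
  show ?thesis
  proof
    assume "is_simple ((QI X)\<lparr>carrier := H\<rparr>)"
    with N have "H \<inter> sublinear_classes X p = {\<one>\<^bsub>QI X\<^esub>} \<or> H \<inter> sublinear_classes X p = H"
      unfolding is_simple_def by simp
    with nontrivial proper show False by simp
  qed
qed

section \<open>Two quasi-isometries of the line and of the ray\<close>

text \<open>On negative arguments \<open>sqrt\<close> is the odd extension, so \<open>x \<mapsto> x + sqrt x\<close> is an increasing
  bijection of the line that fixes \<open>0\<close>. That its displacement is sublinear is the inequality
  of arithmetic and geometric means for \<open>e * \<bar>x\<bar>\<close> and \<open>1 / e\<close>, whose product is \<open>\<bar>x\<bar>\<close>.\<close>

lemma abs_sqrt_le: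
  fixes x e :: real
  assumes "e > 0"
  shows "\<bar>sqrt x\<bar> \<le> e * \<bar>x\<bar> + 1 / e"
proof -
  have "\<bar>x\<bar> \<le> (e * \<bar>x\<bar>)\<^sup>2 + 2 * \<bar>x\<bar> + (1 / e)\<^sup>2" by simp
  also have "\<dots> = (e * \<bar>x\<bar> + 1 / e)\<^sup>2" using assms by (simp add: power2_sum)
  finally have "sqrt \<bar>x\<bar> \<le> e * \<bar>x\<bar> + 1 / e" using assms by (intro real_le_lsqrt) auto
  then show ?thesis by (simp add: sqrt_def real_root_abs)
qed

lemma abs_sqrt_diff_le: "\<bar>sqrt x - sqrt y\<bar> \<le> \<bar>x - y\<bar> + 2" for x y :: real
proof -
  have *: "sqrt x - sqrt y \<le> x - y + 2" if "y \<le> x" for x y :: real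
  proof -
    have t: "sqrt t \<le> t + 1" if "t \<ge> 0" for t :: real using abs_sqrt_le[of 1 t] that by simp
    consider "y \<ge> 0" | "y < 0" "x \<ge> 0" | "x < 0" by linarith
    then show ?thesis
    proof cases
      case 1
      then show ?thesis using sqrt_add_le_add_sqrt[of y "x - y"] t[of "x - y"] that by simp
    next
      case 2
      then show ?thesis using t[of x] t[of "- y"] by (simp add: real_sqrt_minus)
    next
      case 3
      then show ?thesis
        using sqrt_add_le_add_sqrt[of "- x" "x - y"] t[of "x - y"] that
        by (simp add: real_sqrt_minus)
    qed
  qed
  have "sqrt y \<le> sqrt x" if "y \<le> x" for x y :: real using that by simp
  then show ?thesis using *[of x y] *[of y x] by (smt (verit))
qed

text \<open>The map expands distances because \<open>sqrt\<close> is increasing, and it is onto by the intermediate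
  value theorem between \<open>0\<close> and \<open>y\<close>, an interval that lies in \<open>X\<close> together with \<open>y\<close>.\<close>

lemma add_sqrt_in_qi_maps:
  fixes X :: "real set"
  assumes X: "X = UNIV \<or> X = {0..}"
  shows "(\<lambda>x\<in>X. x + sqrt x) \<in> qi_maps X"
proof -
  have "quasi_isometry X X (\<lambda>x\<in>X. x + sqrt x)"
  proof (rule quasi_isometryI[where K = 2 and a = 2 and L = 1 and b = 0 and c = 0])
    show "(\<lambda>x\<in>X. x + sqrt x) \<in> X \<rightarrow> X" using X by auto
    fix x x' assume x: "x \<in> X" "x' \<in> X"
    show "dist ((\<lambda>x\<in>X. x + sqrt x) x) ((\<lambda>x\<in>X. x + sqrt x) x') \<le> 2 * dist x x' + 2"
      using abs_sqrt_diff_le[of x x'] x abs_triangle_ineq[of "x - x'" "sqrt x - sqrt x'"]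
      by (simp add: dist_real_def algebra_simps)
    show "dist x x' \<le> 1 * dist ((\<lambda>x\<in>X. x + sqrt x) x) ((\<lambda>x\<in>X. x + sqrt x) x') + 0"
    proof (cases "x \<le> x'")
      case True
      then have "sqrt x \<le> sqrt x'" by simp
      with True have "\<bar>x - x'\<bar> \<le> \<bar>x + sqrt x - (x' + sqrt x')\<bar>" by (smt (verit))
      with x show ?thesis by (simp add: dist_real_def)
    next
      case False
      then have "sqrt x' \<le> sqrt x" by simp
      with False have "\<bar>x - x'\<bar> \<le> \<bar>x + sqrt x - (x' + sqrt x')\<bar>" by (smt (verit))
      with x show ?thesis by (simp add: dist_real_def)
    qed
  next
    fix y assume y: "y \<in> X"
    have cont: "continuous_on A (\<lambda>x. x + sqrt x)" for A :: "real set"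
      by (intro continuous_intros)
    have "\<exists>x\<in>X. x + sqrt x = y"
    proof (cases "y \<ge> 0")
      case True
      have "\<exists>x\<ge>0. x \<le> y \<and> x + sqrt x = y" by (rule IVT'[OF _ _ True cont]) (use True in auto)
      with X show ?thesis by auto
    next
      case False
      then have "\<exists>x\<ge>y. x \<le> 0 \<and> x + sqrt x = y" by (intro IVT'[OF _ _ _ cont]) auto
      with False y X show ?thesis by auto
    qed
    then show "\<exists>x\<in>X. dist ((\<lambda>x\<in>X. x + sqrt x) x) y \<le> 0" by auto
  qed
  then show ?thesis by (simp add: qi_maps_def)
qed

lemma sublinear_displacement_add_sqrt:
  fixes X :: "real set"
  shows "sublinear_on X 0 (\<lambda>x. dist ((\<lambda>x\<in>X. x + sqrt x) x) x)"
  unfolding sublinear_on_def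
proof (intro allI impI)
  fix e :: real assume "e > 0"
  then have "\<forall>x\<in>X. dist ((\<lambda>x\<in>X. x + sqrt x) x) x \<le> e * dist x 0 + 1 / e"
    using abs_sqrt_le[of e] by (simp add: dist_real_def)
  then show "\<exists>D. \<forall>x\<in>X. dist ((\<lambda>x\<in>X. x + sqrt x) x) x \<le> e * dist x 0 + D" by blast
qed

lemma add_sqrt_not_near_id:
  fixes X :: "real set"
  assumes "{0..} \<subseteq> X"
  shows "((\<lambda>x\<in>X. x + sqrt x), \<lambda>x\<in>X. x) \<notin> qi_rel X"
proof
  assume "((\<lambda>x\<in>X. x + sqrt x), \<lambda>x\<in>X. x) \<in> qi_rel X"
  then obtain D where D: "\<And>x. x \<in> X \<Longrightarrow> \<bar>sqrt x\<bar> \<le> D"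
    by (auto simp: qi_rel_iff dist_real_def)
  \<comment> \<open>The displacement at this point is \<open>\<bar>D\<bar> + 1\<close>.\<close>
  have "(\<bar>D\<bar> + 1)\<^sup>2 \<in> X" using assms by auto
  from D[OF this] show False by simp
qed

lemma double_in_qi_maps:
  fixes X :: "real set"
  assumes X: "X = UNIV \<or> X = {0..}"
  shows "(\<lambda>x\<in>X. 2 * x) \<in> qi_maps X"
proof -
  have "quasi_isometry X X (\<lambda>x\<in>X. 2 * x)"
  proof (rule quasi_isometryI[where K = 2 and a = 0 and L = 1 and b = 0 and c = 0])
    show "(\<lambda>x\<in>X. 2 * x) \<in> X \<rightarrow> X" using X by auto
    fix y assume "y \<in> X"
    then have "y / 2 \<in> X" using X by auto
    then show "\<exists>x\<in>X. dist ((\<lambda>x\<in>X. 2 * x) x) y \<le> 0" by (intro bexI[of _ "y / 2"]) auto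
  next
    fix x x' assume "x \<in> X" "x' \<in> X"
    then have "dist ((\<lambda>x\<in>X. 2 * x) x) ((\<lambda>x\<in>X. 2 * x) x') = 2 * dist x x'"
      by (simp add: dist_real_def abs_if)
    then show "dist ((\<lambda>x\<in>X. 2 * x) x) ((\<lambda>x\<in>X. 2 * x) x') \<le> 2 * dist x x' + 0"
      "dist x x' \<le> 1 * dist ((\<lambda>x\<in>X. 2 * x) x) ((\<lambda>x\<in>X. 2 * x) x') + 0"
      by simp_all
  qed
  then show ?thesis by (simp add: qi_maps_def)
qed

lemma not_sublinear_displacement_double:
  fixes X :: "real set"
  assumes "{0..} \<subseteq> X"
  shows "\<not> sublinear_on X 0 (\<lambda>x. dist ((\<lambda>x\<in>X. 2 * x) x) x)"
proof
  assume *: "sublinear_on X 0 (\<lambda>x. dist ((\<lambda>x\<in>X. 2 * x) x) x)"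
  have half: "(1 / 2 :: real) > 0" by simp
  obtain D where D: "\<And>x. x \<in> X \<Longrightarrow> dist ((\<lambda>x\<in>X. 2 * x) x) x \<le> 1 / 2 * dist x 0 + D"
    by (rule sublinear_onD[OF * half]) (rule that)
  have "2 * \<bar>D\<bar> + 2 \<in> X" using assms by auto
  from D[OF this] this have "2 * \<bar>D\<bar> + 2 \<le> (2 * \<bar>D\<bar> + 2) / 2 + D" by (simp add: dist_real_def)
  with abs_ge_self[of D] show False by argo
qed

theorem theorem1p1:
  shows "\<not> is_simple QI_plus \<and> \<not> is_simple (QI {0::real..})"
proof
  have "filterlim (\<lambda>x::real. x + sqrt x) at_top at_top"
    by (rule filterlim_at_top_mono[OF filterlim_ident])
      (auto intro: eventually_mono[OF eventually_ge_at_top[of 0]])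
  moreover have "filterlim (\<lambda>x::real. x + sqrt x) at_bot at_bot"
    by (rule filterlim_at_bot_mono[OF filterlim_ident])
      (auto intro: eventually_mono[OF eventually_le_at_bot[of 0]])
  moreover have "filterlim (\<lambda>x::real. 2 * x) at_top at_top"
    by (rule filterlim_at_top_mono[OF filterlim_ident])
      (auto intro: eventually_mono[OF eventually_ge_at_top[of 0]])
  moreover have "filterlim (\<lambda>x::real. 2 * x) at_bot at_bot"
    by (rule filterlim_at_bot_mono[OF filterlim_ident])
      (auto intro: eventually_mono[OF eventually_le_at_bot[of 0]])
  ultimately have plus: "qi_rel UNIV `` {\<lambda>x\<in>UNIV. x + sqrt x} \<in> qi_plus_classes"
    "qi_rel UNIV `` {\<lambda>x\<in>UNIV. 2 * x} \<in> qi_plus_classes"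
    using add_sqrt_in_qi_maps[of UNIV] double_in_qi_maps[of UNIV]
    unfolding qi_plus_classes_def restrict_UNIV by blast+
  show "\<not> is_simple QI_plus"
    unfolding QI_plus_def
    by (rule not_simple_if_sublinear_and_not_sublinear[OF subgroup_qi_plus
          add_sqrt_in_qi_maps plus(1) sublinear_displacement_add_sqrt add_sqrt_not_near_id
          double_in_qi_maps plus(2) not_sublinear_displacement_double]) simp_all
  have "\<not> is_simple ((QI {0::real..})\<lparr>carrier := carrier (QI {0::real..})\<rparr>)"
    by (rule not_simple_if_sublinear_and_not_sublinear[OF group.subgroup_self[OF group_QI]
          add_sqrt_in_qi_maps QI_carrierI[OF add_sqrt_in_qi_maps]
          sublinear_displacement_add_sqrt add_sqrt_not_near_id
          double_in_qi_maps QI_carrierI[OF double_in_qi_maps]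
          not_sublinear_displacement_double]) simp_all
  then show "\<not> is_simple (QI {0::real..})" by simp
qed

end
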